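(* The function $F:[0,1]\to[0,1]$, the limit of the normalized numbers of nonzero states of $T_a$ (defined in the context), is given by $$F(x)=\sum_{i=0}^{\infty} x_i\,4^{\sum_{j=0}^{i-1}x_j}\left(\sum_{j=i}^{\infty}\frac{1-x_j}{2^j}\right)^2,$$ where $x=\sum_{i=0}^{\infty}x_i2^{-i}$ with $x_i\in\{0,1\}$ is the binary expansion of $x$, and the finite binary expansion is adopted if $x\in[0,1]$ has two binary expansions.
   Context: A two-dimensional elementary cellular automaton is a map $T:\{0,1\}^{\mathbb{Z}^2}\to\{0,1\}^{\mathbb{Z}^2}$ such that $(Tx)_{i,j}$ is given by a fixed local rule $f:\{0,1\}^5\to\{0,1\}$ applied to the center $C=x_{i,j}$ and its four von Neumann neighbors $U=x_{i,j+1}$, $D=x_{i,j-1}$, $L=x_{i-1,j}$, $R=x_{i+1,j}$. It is symmetrical if $f$ is invariant under left-right and top-bottom reflections and under rotations by multiples of $90^\circ$ of the four neighbors. Call two neighbors opposite if they are $\{U,D\}$ or $\{L,R\}$, and adjacent otherwise. $T_a$ denotes any symmetrical two-dimensional elementary cellular automaton whose local rule satisfies the following. If $C=0$: output $0$ if no neighbor is $1$; output $1$ if exactly one neighbor is $1$; output $0$ if exactly two neighbors are $1$ and they are adjacent; output $1$ if exactly two neighbors are $1$ and they are opposite; output $1$ if all four neighbors are $1$; if exactly three neighbors are $1$ the output is arbitrary. If $C=1$: output $0$ if no neighbor is $1$; all other outputs are arbitrary. (The arbitrary values, chosen compatibly with the symmetry, do not affect the orbit considered.) The single site seed $x_o\in\{0,1\}^{\mathbb{Z}^2}$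 has $(x_o)_{0,0}=1$ and all other entries $0$. Define $num_a(0)=0$ and, for $t\ge1$, $num_a(t)=\sum_{(i,j)\in\mathbb{Z}^2}(T_a^{t-1}x_o)_{i,j}$. Binary expansions: $x\in[0,1]$ is written $x=\sum_{i=0}^{\infty}x_i2^{-i}$, $x_i\in\{0,1\}$, using the finite expansion whenever there are two (so $x_0=1$ only for $x=1$). For $k>0$ and $x=t/2^k$ with $t$ an integer, $0\le t\le 2^k$, put $F_k(x)=num_a(t)/num_a(2^k)$. For $x\in[0,1]$ with truncations $x|_k=\sum_{i=0}^{k}x_i2^{-i}$, $F(x)=\lim_{k\to\infty}F_k(x|_k)$. Empty sums are $0$. *)

theory Defs
  imports "HOL-Analysis.Analysis"
begin

text \<open>
  A configuration is a map from the lattice to \<^typ>\<open>bool\<close>, with \<^const>\<open>True\<close> for the state 1.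
  The arguments of a local rule come in the order centre, up, down, left, right.
\<close>

type_synonym config = "int \<times> int \<Rightarrow> bool"
type_synonym rule = "bool \<Rightarrow> bool \<Rightarrow> bool \<Rightarrow> bool \<Rightarrow> bool \<Rightarrow> bool"

definition CA :: "rule \<Rightarrow> config \<Rightarrow> config" where
  "CA f x = (\<lambda>(i, j). f (x (i, j)) (x (i, j + 1)) (x (i, j - 1)) (x (i - 1, j)) (x (i + 1, j)))"

text \<open>The three laws are left-right reflection, top-bottom reflection and a quarter turn.\<close>

definition symmetrical :: "rule \<Rightarrow> bool" where
  "symmetrical f \<longleftrightarrow>
     (\<forall>c u d l r. f c u d r l = f c u d l r) \<and>
     (\<forall>c u d l r. f c d u l r = f c u d l r) \<and>
     (\<forall>c u d l r. f c r l u d = f c u d l r)"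

definition num_ones :: "bool \<Rightarrow> bool \<Rightarrow> bool \<Rightarrow> bool \<Rightarrow> nat" where
  "num_ones u d l r = of_bool u + of_bool d + of_bool l + of_bool r"

definition opposite_pair :: "bool \<Rightarrow> bool \<Rightarrow> bool \<Rightarrow> bool \<Rightarrow> bool" where
  "opposite_pair u d l r \<longleftrightarrow> num_ones u d l r = 2 \<and> (u \<and> d \<or> l \<and> r)"

definition adjacent_pair :: "bool \<Rightarrow> bool \<Rightarrow> bool \<Rightarrow> bool \<Rightarrow> bool" where
  "adjacent_pair u d l r \<longleftrightarrow> num_ones u d l r = 2 \<and> \<not> opposite_pair u d l r"

definition is_Ta_rule :: "rule \<Rightarrow> bool" where
  "is_Ta_rule f \<longleftrightarrow> symmetrical f \<and>
     (\<forall>u d l r.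
        (num_ones u d l r = 0 \<longrightarrow> f False u d l r = False) \<and>
        (num_ones u d l r = 1 \<longrightarrow> f False u d l r = True) \<and>
        (adjacent_pair u d l r \<longrightarrow> f False u d l r = False) \<and>
        (opposite_pair u d l r \<longrightarrow> f False u d l r = True) \<and>
        (num_ones u d l r = 4 \<longrightarrow> f False u d l r = True) \<and>
        (num_ones u d l r = 0 \<longrightarrow> f True u d l r = False))"

definition seed :: config where
  "seed = (\<lambda>p. p = (0, 0))"

definition num_a :: "rule \<Rightarrow> nat \<Rightarrow> nat" where
  "num_a f t = (if t = 0 then 0 else (\<Sum>\<^sub>\<infinity>p\<in>UNIV. of_bool (((CA f ^^ (t - 1)) seed) p)))"


text \<open>Sequences of binary digits start with the coefficient of \<open>2^0\<close>.\<close>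

definition binary_expansion :: "real \<Rightarrow> (nat \<Rightarrow> nat) \<Rightarrow> bool" where
  "binary_expansion x b \<longleftrightarrow> (\<forall>i. b i \<in> {0, 1}) \<and> (\<lambda>i. real (b i) / 2 ^ i) sums x"

definition adopted_expansion :: "real \<Rightarrow> (nat \<Rightarrow> nat) \<Rightarrow> bool" where
  "adopted_expansion x b \<longleftrightarrow> binary_expansion x b \<and>
     ((\<exists>b'. b' \<noteq> b \<and> binary_expansion x b') \<longrightarrow> finite {i. b i \<noteq> 0})"

definition digit :: "real \<Rightarrow> nat \<Rightarrow> nat" where
  "digit x = (THE b. adopted_expansion x b)"

definition trunc :: "real \<Rightarrow> nat \<Rightarrow> real" where
  "trunc x k = (\<Sum>i\<le>k. real (digit x i) / 2 ^ i)"

text \<open>\<open>F_dyadic f k x\<close> is only meaningful when \<open>x = t / 2^k\<close> for some natural number \<open>t\<close>.\<close>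

definition F_dyadic :: "rule \<Rightarrow> nat \<Rightarrow> real \<Rightarrow> real" where
  "F_dyadic f k x = real (num_a f (THE t. x = real t / 2 ^ k)) / real (num_a f (2 ^ k))"

definition F_limit :: "rule \<Rightarrow> real \<Rightarrow> real" where
  "F_limit f x = lim (\<lambda>k. F_dyadic f k (trunc x k))"


text \<open>
  The adopted expansion of a point of the unit interval exists and is unique, so the
  definite description in \<^const>\<open>digit\<close> is well-defined; it is given by the usual floor formula.
\<close>

definition floor_digit :: "real \<Rightarrow> nat \<Rightarrow> nat" where
  "floor_digit x i = nat (\<lfloor>x * 2 ^ i\<rfloor> mod 2)"

lemma floor_digit_expansion:
  assumes "x \<in> {0..1}"
  shows "binary_expansion x (floor_digit x)"
proof -
  have bits: "floor_digit x i \<in> {0, 1}" for i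
    unfolding floor_digit_def by auto
  have step: "real_of_int \<lfloor>x * 2 ^ Suc n\<rfloor> = 2 * real_of_int \<lfloor>x * 2 ^ n\<rfloor> + real (floor_digit x (Suc n))" for n
  proof -
    define y where "y = x * 2 ^ n"
    have "\<lfloor>2 * y\<rfloor> = 2 * \<lfloor>y\<rfloor> \<or> \<lfloor>2 * y\<rfloor> = 2 * \<lfloor>y\<rfloor> + 1" by linarith
    hence "\<lfloor>2 * y\<rfloor> = 2 * \<lfloor>y\<rfloor> + \<lfloor>2 * y\<rfloor> mod 2" by auto
    hence "real_of_int \<lfloor>2 * y\<rfloor> = real_of_int (2 * \<lfloor>y\<rfloor> + \<lfloor>2 * y\<rfloor> mod 2)" by metis
    moreover have "real (floor_digit x (Suc n)) = real_of_int (\<lfloor>2 * y\<rfloor> mod 2)"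
      unfolding floor_digit_def y_def by (simp add: mult.left_commute)
    moreover have "x * 2 ^ Suc n = 2 * y" unfolding y_def by simp
    ultimately show ?thesis unfolding y_def[symmetric] by (simp only: of_int_add of_int_mult of_int_numeral)
  qed
  have zero: "real (floor_digit x 0) = real_of_int \<lfloor>x\<rfloor>"
  proof -
    have "\<lfloor>x\<rfloor> = 0 \<or> \<lfloor>x\<rfloor> = 1" using assms by (auto simp: floor_eq_iff)
    thus ?thesis unfolding floor_digit_def by auto
  qed
  have part: "(\<Sum>i\<le>n. real (floor_digit x i) / 2 ^ i) = \<lfloor>x * 2 ^ n\<rfloor> / 2 ^ n" for n
  proof (induction n)
    case 0
    then show ?case using zero by simp
  next
    case (Suc n)
    have "(\<Sum>i\<le>Suc n. real (floor_digit x i) / 2 ^ i)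
        = \<lfloor>x * 2 ^ n\<rfloor> / 2 ^ n + real (floor_digit x (Suc n)) / 2 ^ Suc n"
      using Suc by simp
    then show ?case unfolding step by (simp add: field_simps)
  qed
  have "(\<lambda>n. \<lfloor>x * 2 ^ n\<rfloor> / 2 ^ n) \<longlonglongrightarrow> x"
  proof (rule tendsto_sandwich)
    show "\<forall>\<^sub>F n in sequentially. x - (1/2) ^ n \<le> \<lfloor>x * 2 ^ n\<rfloor> / 2 ^ n"
    proof (rule always_eventually, rule allI)
      fix n
      have "x * 2 ^ n - 1 \<le> \<lfloor>x * 2 ^ n\<rfloor>" by linarith
      hence "(x * 2 ^ n - 1) / 2 ^ n \<le> \<lfloor>x * 2 ^ n\<rfloor> / 2 ^ n" by (intro divide_right_mono) auto
      moreover have "(x * 2 ^ n - 1) / 2 ^ n = x - (1/2) ^ n"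
        by (simp add: diff_divide_distrib power_divide)
      ultimately show "x - (1/2) ^ n \<le> \<lfloor>x * 2 ^ n\<rfloor> / 2 ^ n" by simp
    qed
    show "\<forall>\<^sub>F n in sequentially. \<lfloor>x * 2 ^ n\<rfloor> / 2 ^ n \<le> x"
      by (rule always_eventually) (simp add: field_simps)
    have "(\<lambda>n. x - (1/2) ^ n) \<longlonglongrightarrow> x - 0"
      by (intro tendsto_intros LIMSEQ_realpow_zero) auto
    thus "(\<lambda>n. x - (1/2) ^ n) \<longlonglongrightarrow> x" by simp
  qed auto
  hence "(\<lambda>i. real (floor_digit x i) / 2 ^ i) sums x"
    unfolding sums_def_le part by simp
  with bits show ?thesis unfolding binary_expansion_def by blast
qed

lemma binary_expansion_tail:
  assumes "binary_expansion x b"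
  obtains N :: int and r :: real where
    "x * 2 ^ i = real_of_int (2 * N + int (b i)) + r"
    "(\<lambda>j. real (b (j + Suc i)) / 2 ^ Suc j) sums r" "0 \<le> r" "r \<le> 1"
    "r = 1 \<longleftrightarrow> (\<forall>j>i. b j = 1)"
proof -
  have bits: "b j = 0 \<or> b j = 1" for j
    using assms unfolding binary_expansion_def by auto
  have s: "(\<lambda>i. real (b i) / 2 ^ i) sums x"
    using assms unfolding binary_expansion_def by blast
  define S where "S = (\<Sum>j<i. int (b j) * 2 ^ (i - Suc j))"
  define r where "r = (x - (\<Sum>j<Suc i. real (b j) / 2 ^ j)) * 2 ^ i"
  have "(\<Sum>j<i. real (b j) / 2 ^ j) * 2 ^ i = real_of_int (2 * S)"
  proof -
    have "real (b j) / 2 ^ j * 2 ^ i = 2 * (real (b j) * 2 ^ (i - Suc j))" if "j < i" for j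
    proof -
      have "(2::real) ^ i = 2 ^ j * 2 * 2 ^ (i - Suc j)"
        using that by (metis Suc_leI le_add_diff_inverse power_Suc2 power_add)
      thus ?thesis by simp
    qed
    thus ?thesis unfolding S_def by (simp add: sum_distrib_left sum_distrib_right)
  qed
  hence eq: "x * 2 ^ i = real_of_int (2 * S + int (b i)) + r"
    unfolding r_def by (simp add: algebra_simps)
  have "(\<lambda>j. real (b (j + Suc i)) / 2 ^ (j + Suc i)) sums (x - (\<Sum>j<Suc i. real (b j) / 2 ^ j))"
    using sums_split_initial_segment[OF s, of "Suc i"] by simp
  hence "(\<lambda>j. real (b (j + Suc i)) / 2 ^ (j + Suc i) * 2 ^ i) sums r"
    unfolding r_def by (rule sums_mult2)
  hence rsm: "(\<lambda>j. real (b (j + Suc i)) / 2 ^ Suc j) sums r"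
    by (simp add: power_add)
  have ds: "(\<lambda>j. (1 - real (b (j + Suc i))) / 2 ^ Suc j) sums (1 - r)"
    using sums_diff[OF power_half_series rsm] by (simp add: diff_divide_distrib power_divide)
  have nn1: "0 \<le> real (b (j + Suc i)) / 2 ^ Suc j" for j by simp
  have n2: "0 \<le> (1 - real (b (j + Suc i))) / 2 ^ Suc j" for j
    using bits[of "j + Suc i"] by auto
  have r0: "0 \<le> r" using sums_le[OF nn1 sums_zero rsm] .
  have r1: "r \<le> 1" using sums_le[OF n2 sums_zero ds] by simp
  have "r = 1 \<longleftrightarrow> (\<forall>j. (1 - real (b (j + Suc i))) / 2 ^ Suc j = 0)"
  proof -
    have "r = 1 \<longleftrightarrow> 1 - r = 0" by linarith
    also have "1 - r = (\<Sum>j. (1 - real (b (j + Suc i))) / 2 ^ Suc j)"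
      by (rule sums_unique[OF ds])
    also have "\<dots> = 0 \<longleftrightarrow> (\<forall>j. (1 - real (b (j + Suc i))) / 2 ^ Suc j = 0)"
      by (rule suminf_eq_zero_iff[OF sums_summable[OF ds] n2])
    finally show ?thesis .
  qed
  also have "\<dots> \<longleftrightarrow> (\<forall>j>i. b j = 1)"
  proof
    assume a: "\<forall>j. (1 - real (b (j + Suc i))) / 2 ^ Suc j = 0"
    show "\<forall>j>i. b j = 1"
    proof (intro allI impI)
      fix j assume "i < j"
      thus "b j = 1" using a[rule_format, of "j - Suc i"] by simp
    qed
  qed simp
  finally show ?thesis using that[OF eq rsm r0 r1] by blast
qed

lemma binary_expansion_eq_floor_digit:
  assumes "binary_expansion x b" "\<And>i. \<exists>j>i. b j \<noteq> 1"
  shows "b = floor_digit x"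
proof
  fix i
  obtain N :: int and r :: real where N: "x * 2 ^ i = real_of_int (2 * N + int (b i)) + r"
    "0 \<le> r" "r \<le> 1" "r = 1 \<longleftrightarrow> (\<forall>j>i. b j = 1)"
    using binary_expansion_tail[OF assms(1), of i] by metis
  have "r < 1" using N assms(2)[of i] by force
  hence "\<lfloor>x * 2 ^ i\<rfloor> = 2 * N + int (b i)" using N by linarith
  moreover have "b i = 0 \<or> b i = 1" using assms(1) unfolding binary_expansion_def by auto
  ultimately show "b i = floor_digit x i" unfolding floor_digit_def by auto
qed

lemma finite_floor_digit:
  assumes "binary_expansion x b" "\<forall>j>i. b j = 1"
  shows "finite {j. floor_digit x j \<noteq> 0}"
proof (rule finite_subset)
  obtain N :: int and r :: real where N: "x * 2 ^ i = real_of_int (2 * N + int (b i)) + r"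
    "r = 1 \<longleftrightarrow> (\<forall>j>i. b j = 1)"
    using binary_expansion_tail[OF assms(1), of i] by metis
  define M where "M = 2 * N + int (b i) + 1"
  have M: "x * 2 ^ i = real_of_int M" using N assms(2) unfolding M_def by simp
  show "{j. floor_digit x j \<noteq> 0} \<subseteq> {..i}"
  proof
    fix j assume nz: "j \<in> {j. floor_digit x j \<noteq> 0}"
    show "j \<in> {..i}"
    proof (rule ccontr)
      assume "j \<notin> {..i}"
      hence j: "j > i" by simp
      have "(2::real) ^ j = 2 ^ i * 2 ^ (j - i)"
        using j by (metis le_add_diff_inverse less_imp_le power_add)
      hence "x * 2 ^ j = x * 2 ^ i * 2 ^ (j - i)" by simp
      also have "\<dots> = real_of_int (M * 2 ^ (j - i))" unfolding M by simp
      finally have "x * 2 ^ j = real_of_int (M * 2 ^ (j - i))" .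
      hence "\<lfloor>x * 2 ^ j\<rfloor> = M * 2 ^ (j - i)" by (metis floor_of_int)
      hence "even \<lfloor>x * 2 ^ j\<rfloor>" using j by simp
      hence "floor_digit x j = 0" unfolding floor_digit_def by (simp add: even_iff_mod_2_eq_zero)
      with nz show False by simp
    qed
  qed
qed simp

lemma adopted_expansion_iff:
  assumes "x \<in> {0..1}"
  shows "adopted_expansion x b \<longleftrightarrow> b = floor_digit x"
proof
  assume "b = floor_digit x"
  thus "adopted_expansion x b"
    using floor_digit_expansion[OF assms] binary_expansion_eq_floor_digit finite_floor_digit
    unfolding adopted_expansion_def by metis
next
  assume b: "adopted_expansion x b"
  hence be: "binary_expansion x b" unfolding adopted_expansion_def by blast
  show "b = floor_digit x"
  proof (rule ccontr)
    assume ne: "b \<noteq> floor_digit x"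
    then obtain i where i: "\<forall>j>i. b j = 1"
      using binary_expansion_eq_floor_digit[OF be] by blast
    have "finite {j. b j \<noteq> 0}"
      using b ne floor_digit_expansion[OF assms] unfolding adopted_expansion_def by metis
    moreover have "{i<..} \<subseteq> {j. b j \<noteq> 0}" using i by auto
    ultimately show False using finite_subset infinite_Ioi by blast
  qed
qed

lemma adopted_expansion_ex1:
  "x \<in> {0..1} \<Longrightarrow> \<exists>!b. adopted_expansion x b"
  by (simp add: adopted_expansion_iff)

lemma digit_eq_floor:
  "x \<in> {0..1} \<Longrightarrow> digit x i = nat (\<lfloor>x * 2 ^ i\<rfloor> mod 2)"
  by (simp add: digit_def adopted_expansion_iff floor_digit_def)

end

theory Submission
  imports Defs
begin

text \<open>
  Let \<open>c(t)\<close> be the configuration after \<open>t - 1\<close> steps, \<open>c(0)\<close> empty, and \<open>a(t)\<close> its number of live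
  cells. The live cells of \<open>c(2^k)\<close> are the sites of the right parity in a taxicab ball of radius
  \<open>2^k - 1\<close>, a diamond of side \<open>2^k\<close>. For \<open>0 \<le> s \<le> 2^k\<close>, \<open>c(2^k + s)\<close> consists of the diamond of side
  \<open>2^k - s\<close> and of four copies of \<open>c(s)\<close> centred at \<open>(\<plusminus>2^k, 0)\<close> and \<open>(0, \<plusminus>2^k)\<close>. The five pieces
  interact only at the four sites just outside the tips of the diamond, where two opposite neighbours
  have the same effect as one. Three live neighbours never occur, and neither does a live cell with a
  live neighbour. Hence \<open>a(2^k + s) = (2^k - s)^2 + 4 a(s)\<close>.

  Unfolding this along the binary digits writes \<open>F\<^sub>k\<close> as a finite sum whose terms converge to those of
  the series. The terms from index \<open>M\<close> on add up to \<open>4^n a(t) / 4^k\<close>, where \<open>n\<close> is the number of ones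
  among the first \<open>M\<close> digits and \<open>t < 2^(k + 1 - M)\<close>. As \<open>a(t) \<le> t^2\<close>, this is at most
  \<open>4 \<cdot> 4^(n - M)\<close>, uniformly in \<open>k\<close>. The adopted expansion has infinitely many zeros, so \<open>M - n\<close>
  tends to infinity and limit and sum can be interchanged.
\<close>

section \<open>Diamonds and the evolution of the orbit\<close>

fun taxicab :: "int \<times> int \<Rightarrow> int" where
  "taxicab (i, j) = \<bar>i\<bar> + \<bar>j\<bar>"

text \<open>The parity condition puts the outermost shell, of norm \<open>n - 1\<close>, into the
  diamond. For \<open>n \<le> 0\<close> the diamond is empty.\<close>

fun diamond :: "int \<Rightarrow> config" where
  "diamond n (i, j) \<longleftrightarrow> \<bar>i\<bar> + \<bar>j\<bar> < n \<and> odd (i + j + n)"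

definition units :: "(int \<times> int) set" where
  "units = {(1, 0), (-1, 0), (0, 1), (0, -1)}"

definition dilate :: "int \<Rightarrow> int \<times> int \<Rightarrow> int \<times> int" where
  "dilate n e = (n * fst e, n * snd e)"

text \<open>Time is shifted by one, as in \<^const>\<open>num_a\<close>, so that \<open>orbit f t\<close> fills at most a diamond of side \<open>t\<close>.\<close>

definition orbit :: "rule \<Rightarrow> nat \<Rightarrow> config" where
  "orbit f t = (if t = 0 then (\<lambda>_. False) else (CA f ^^ (t - 1)) seed)"

lemma taxicab_unit:
  "e \<in> units \<Longrightarrow> taxicab p - 1 \<le> taxicab (p + e)"
  by (cases p) (auto simp: units_def)

lemma diamond_taxicab: "diamond n p \<Longrightarrow> taxicab p < n"
  by (cases p) simp

lemma orbit_0 [simp]: "orbit f 0 p = False"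
  by (simp add: orbit_def)

lemma orbit_1 [simp]: "orbit f (Suc 0) = seed"
  by (simp add: orbit_def)

lemma orbit_Suc: "t > 0 \<Longrightarrow> orbit f (Suc t) = CA f (orbit f t)"
  by (cases t) (simp_all add: orbit_def)

section \<open>Locality, the local rule and the light cone\<close>

lemma CA_local:
  assumes "x p = y p" "\<And>e. e \<in> units \<Longrightarrow> x (p + e) = y (p + e)"
  shows "CA f x p = CA f y p"
proof (cases p)
  case (Pair i j)
  show ?thesis
    using assms(1) assms(2)[of "(0, 1)"] assms(2)[of "(0, -1)"] assms(2)[of "(-1, 0)"] assms(2)[of "(1, 0)"]
    by (simp add: CA_def Pair units_def)
qed

lemma CA_shift: "CA f (\<lambda>p. x (p - c)) p = CA f x (p - c)"
  by (cases p; cases c) (simp add: CA_def algebra_simps)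

lemma Ta_rule:
  assumes "is_Ta_rule f"
  shows "\<not> f c False False False False"
    and "f False True True True True"
    and "num_ones u d l r = 1 \<Longrightarrow> f False u d l r"
    and "adjacent_pair u d l r \<Longrightarrow> \<not> f False u d l r"
    and "opposite_pair u d l r \<Longrightarrow> f False u d l r"
proof -
  note rule = assms[unfolded is_Ta_rule_def, THEN conjunct2, rule_format]
  show "\<not> f c False False False False"
    using rule[of False False False False] by (cases c) (simp_all add: num_ones_def)
  show "f False True True True True"
    using rule[of True True True True] by (simp add: num_ones_def)
  show "num_ones u d l r = 1 \<Longrightarrow> f False u d l r"
    and "adjacent_pair u d l r \<Longrightarrow> \<not> f False u d l r"
    and "opposite_pair u d l r \<Longrightarrow> f False u d l r"
    using rule[of u d l r] by blast+
qed

text \<open>Without live neighbours both states of the centre lead to 0, so activity spreads at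
  speed at most one.\<close>

lemma CA_live:
  assumes "is_Ta_rule f" "CA f x p"
  shows "\<exists>e\<in>units. x (p + e)"
proof (rule ccontr)
  assume no: "\<not> ?thesis"
  obtain i j where p: "p = (i, j)" by force
  have "\<not> x (i, j + 1)" "\<not> x (i, j - 1)" "\<not> x (i - 1, j)" "\<not> x (i + 1, j)"
    using no by (simp_all add: p units_def)
  then show False
    using assms(2) Ta_rule(1)[OF assms(1)] by (simp add: CA_def p)
qed

text \<open>A live cell needs a live neighbour one step earlier; going there flips the parity of
  \<open>i + j\<close> and lowers the taxicab norm by at most one.\<close>

lemma orbit_diamond:
  assumes f: "is_Ta_rule f"
  shows "orbit f t p \<Longrightarrow> diamond (int t) p"
proof (induction t arbitrary: p)
  case (Suc t)
  show ?case
  proof (cases "t = 0")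
    case True
    then show ?thesis using Suc.prems by (simp add: seed_def)
  next
    case False
    then have "CA f (orbit f t) p" using Suc.prems by (simp add: orbit_Suc)
    then obtain e where "e \<in> units" "orbit f t (p + e)"
      using CA_live[OF f] by blast
    then have e: "e \<in> units" "diamond (int t) (p + e)"
      using Suc.IH by blast+
    obtain i j where p: "p = (i, j)" by force
    have "taxicab p < int (Suc t)"
      using diamond_taxicab[OF e(2)] taxicab_unit[OF e(1), of p] by simp
    moreover have "odd (i + j + int (Suc t))"
      using e unfolding units_def p
      by (elim insertE emptyE) (simp, blast)+
    ultimately show ?thesis by (simp add: p)
  qed
qed simp

lemma orbit_taxicab:
  "is_Ta_rule f \<Longrightarrow> orbit f t p \<Longrightarrow> taxicab p < int t"
  using orbit_diamond diamond_taxicab by blast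

lemma CA_one_neighbour:
  assumes f: "is_Ta_rule f" and e: "e \<in> units"
    and x: "\<not> x p" "x (p + e)" "\<And>d. d \<in> units \<Longrightarrow> d \<noteq> e \<Longrightarrow> \<not> x (p + d)"
  shows "CA f x p"
proof -
  obtain i j where p: "p = (i, j)" by force
  have "f False (x (i, j + 1)) (x (i, j - 1)) (x (i - 1, j)) (x (i + 1, j))"
    using e x(2) x(3)[of "(0, 1)"] x(3)[of "(0, -1)"] x(3)[of "(-1, 0)"] x(3)[of "(1, 0)"]
    by (intro Ta_rule(3)[OF f]) (auto simp: p units_def num_ones_def)
  then show ?thesis using x(1) by (simp add: CA_def p)
qed

lemma CA_opposite_neighbours:
  assumes f: "is_Ta_rule f" and e: "e \<in> units"
    and x: "\<not> x p" "x (p + e)" "x (p - e)"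
      "\<And>d. d \<in> units \<Longrightarrow> d \<noteq> e \<Longrightarrow> d \<noteq> - e \<Longrightarrow> \<not> x (p + d)"
  shows "CA f x p"
proof -
  obtain i j where p: "p = (i, j)" by force
  have "f False (x (i, j + 1)) (x (i, j - 1)) (x (i - 1, j)) (x (i + 1, j))"
    using e x(2-3) x(4)[of "(0, 1)"] x(4)[of "(0, -1)"] x(4)[of "(-1, 0)"] x(4)[of "(1, 0)"]
    by (intro Ta_rule(5)[OF f]) (auto simp: p units_def num_ones_def opposite_pair_def)
  then show ?thesis using x(1) by (simp add: CA_def p)
qed

text \<open>Only the neighbour behind the new tip lies in the light cone of the step before, and it
  is the old tip. So exactly one neighbour is live.\<close>

lemma orbit_tip:
  assumes f: "is_Ta_rule f" and e: "e \<in> units"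
  shows "orbit f (Suc t) (dilate (int t) e)"
proof (induction t)
  case 0
  then show ?case by (simp add: seed_def dilate_def)
next
  case (Suc t)
  let ?p = "dilate (int (Suc t)) e"
  have dead: "\<not> orbit f (Suc t) q" if "taxicab q \<ge> int (Suc t)" for q
    using orbit_taxicab[OF f, of "Suc t" q] that by auto
  have "CA f (orbit f (Suc t)) ?p"
  proof (rule CA_one_neighbour[OF f])
    show "- e \<in> units" using e by (auto simp: units_def)
    show "\<not> orbit f (Suc t) ?p"
      using e by (intro dead) (auto simp: units_def dilate_def)
    have "?p + - e = dilate (int t) e"
      by (cases e) (simp add: dilate_def algebra_simps)
    then show "orbit f (Suc t) (?p + - e)" using Suc by simp
    show "\<not> orbit f (Suc t) (?p + d)" if "d \<in> units" "d \<noteq> - e" for d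
      using e that by (intro dead) (auto simp: units_def dilate_def)
  qed
  then show ?case using orbit_Suc[of "Suc t"] by simp
qed

section \<open>One step of a diamond and of the cross\<close>

text \<open>Sites of the diamond's own parity have only dead neighbours. On the other parity the
  distance \<open>d\<close> decides: inside, all four neighbours are live; at \<open>d = m\<close>
  only the inward ones are, a single one on the axes and an adjacent pair elsewhere; beyond, none
  is.\<close>

lemma CA_diamond:
  assumes f: "is_Ta_rule f" and m: "m \<ge> 1"
  shows "CA f (diamond m) p \<longleftrightarrow> diamond (m - 1) p \<or> p \<in> dilate m ` units"
proof -
  obtain i j where p: "p = (i, j)" by force
  let ?x = "diamond m"
  show ?thesis
  proof (cases "even (i + j + m)")
    case False
    then have "\<not> ?x (p + e)" if "e \<in> units" for e
      using that by (auto simp: p units_def)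
    then have "\<not> CA f ?x p"
      using CA_live[OF f] by blast
    moreover have "p \<notin> dilate m ` units"
      using False by (auto simp: p units_def dilate_def)
    ultimately show ?thesis using False by (simp add: p)
  next
    case True
    define d where "d = \<bar>i\<bar> + \<bar>j\<bar>"
    have par: "even (d + m)" using True by (simp add: d_def)
    have CA: "CA f ?x p = f False (\<bar>i\<bar> + \<bar>j + 1\<bar> < m) (\<bar>i\<bar> + \<bar>j - 1\<bar> < m)
        (\<bar>i - 1\<bar> + \<bar>j\<bar> < m) (\<bar>i + 1\<bar> + \<bar>j\<bar> < m)"
      using True by (cases "even i"; cases "even j"; cases "even m") (simp_all add: CA_def p)
    have "d \<le> m - 2 \<or> d = m \<or> d \<ge> m + 2"
      using par by presburger
    then consider "\<bar>i\<bar> + \<bar>j\<bar> \<le> m - 2" | "\<bar>i\<bar> + \<bar>j\<bar> = m" | "\<bar>i\<bar> + \<bar>j\<bar> \<ge> m + 2"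
      unfolding d_def by blast
    then show ?thesis
    proof cases
      case 1
      then have "\<bar>i\<bar> + \<bar>j + 1\<bar> < m" "\<bar>i\<bar> + \<bar>j - 1\<bar> < m" "\<bar>i - 1\<bar> + \<bar>j\<bar> < m" "\<bar>i + 1\<bar> + \<bar>j\<bar> < m"
        by arith+
      then have "CA f ?x p" unfolding CA using Ta_rule(2)[OF f] by simp
      then show ?thesis using 1 True by (simp add: p)
    next
      case 2
      have s: "p \<in> dilate m ` units \<longleftrightarrow> i = 0 \<or> j = 0"
        using 2 by (simp add: p units_def dilate_def) arith
      have d: "\<not> diamond (m - 1) p" using 2 by (simp add: p)
      \<comment> \<open>On the shell a neighbour is live exactly when it is nearer to the
        origin.\<close>
      have "CA f ?x p = f False (j < 0) (j > 0) (i > 0) (i < 0)"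
        unfolding CA by (simp add: 2[symmetric] abs_if)
      moreover have "f False (j < 0) (j > 0) (i > 0) (i < 0)" if "i = 0 \<or> j = 0"
        using that 2 m by (intro Ta_rule(3)[OF f]) (auto simp: num_ones_def)
      moreover have "\<not> f False (j < 0) (j > 0) (i > 0) (i < 0)" if "\<not> (i = 0 \<or> j = 0)"
        using that by (intro Ta_rule(4)[OF f]) (auto simp: num_ones_def adjacent_pair_def opposite_pair_def)
      ultimately show ?thesis using s d by blast
    next
      case 3
      then have "\<not> \<bar>i\<bar> + \<bar>j + 1\<bar> < m" "\<not> \<bar>i\<bar> + \<bar>j - 1\<bar> < m"
        "\<not> \<bar>i - 1\<bar> + \<bar>j\<bar> < m" "\<not> \<bar>i + 1\<bar> + \<bar>j\<bar> < m"
        by arith+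
      then have "\<not> CA f ?x p" unfolding CA using Ta_rule(1)[OF f] by simp
      moreover have "p \<notin> dilate m ` units"
        using 3 m by (simp add: p units_def dilate_def) arith
      ultimately show ?thesis using 3 m by (simp add: p)
    qed
  qed
qed

text \<open>For \<open>s \<le> 2 ^ k\<close>, \<open>cross f (2 ^ k) s\<close> is the orbit at time \<open>2 ^ k + s\<close>.\<close>

definition cross :: "rule \<Rightarrow> int \<Rightarrow> nat \<Rightarrow> config" where
  "cross f n s p \<longleftrightarrow> diamond (n - int s) p \<or> (\<exists>e\<in>units. orbit f s (p - dilate n e))"

text \<open>The distances to the origin and to \<open>dilate n e\<close> add up to at least
  \<open>n\<close> plus twice the offset from the axis. So both bounds can hold only on the axis,
  and there at one point.\<close>

lemma taxicab_tip:
  assumes "e \<in> units" "taxicab p \<le> m" "taxicab (p - dilate n e) \<le> n - m"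
  shows "p = dilate m e"
  using assms by (cases p) (auto simp: units_def dilate_def)

text \<open>Two distinct centres, opposite or not, are \<open>2 * n\<close> apart in the taxicab
  norm; the rest is the triangle inequality.\<close>

lemma taxicab_centres:
  assumes "e \<in> units" "d \<in> units" "d \<noteq> e" "n \<ge> 0"
  shows "2 * n - taxicab (p - dilate n e) \<le> taxicab (p - dilate n d)"
  using assms by (cases p) (auto simp: units_def dilate_def)

text \<open>Away from the tips \<open>dilate m e\<close> a site and its neighbours meet live cells
  of at most one of the five pieces, so locality reduces the step to that piece. At a tip the
  diamond and one copy act together.\<close>

lemma CA_cross:
  assumes f: "is_Ta_rule f" and s: "0 < s" "int s < n"
  shows "CA f (cross f n s) p \<longleftrightarrow> cross f n (Suc s) p"
proof -
  define m where "m = n - int s"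
  have m: "m \<ge> 1" "n - m = int s" "n - int s = m" "n - (1 + int s) = m - 1"
    using s by (auto simp: m_def)
  note near = orbit_taxicab[OF f]
  consider (tip) e where "e \<in> units" "p = dilate m e"
    | (centre) "p \<notin> dilate m ` units" "taxicab p \<le> m"
    | (copy) e where "e \<in> units" "taxicab p > m" "taxicab (p - dilate n e) \<le> int s"
    | (far) "taxicab p > m" "\<And>e. e \<in> units \<Longrightarrow> taxicab (p - dilate n e) > int s"
    by fastforce
  then show ?thesis
  proof cases
    case tip
    obtain t where t: "s = Suc t" using s by (cases s) auto
    have e': "- e \<in> units" using tip by (auto simp: units_def)
    have dead: "\<not> cross f n s q"
      if "taxicab q \<ge> m" "\<And>d. d \<in> units \<Longrightarrow> taxicab (q - dilate n d) \<ge> int s" for q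
      using that near[of s] diamond_taxicab[of m q] unfolding cross_def m by (meson not_less)
    have "p - dilate n e = dilate (int s) (- e)"
      by (simp add: tip m_def dilate_def algebra_simps)
    then have "orbit f (Suc s) (p - dilate n e)"
      using orbit_tip[OF f e'] by simp
    then have "cross f n (Suc s) p" using tip by (auto simp: cross_def)
    moreover have "CA f (cross f n s) p"
    proof (rule CA_opposite_neighbours[OF f \<open>e \<in> units\<close>])
      show "\<not> cross f n s p"
        using tip s by (intro dead) (auto simp: units_def dilate_def m_def)
      \<comment> \<open>Behind \<open>p\<close> lies the tip of the diamond, and ahead the tip of
        the copy that faces the origin; \<open>t = s - 1\<close> because \<open>orbit f s\<close>
        reaches only distance \<open>s - 1\<close>.\<close>
      have "p + e - dilate n e = dilate (int t) (- e)"
        by (cases e) (simp add: tip m_def dilate_def algebra_simps t)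
      then have "orbit f s (p + e - dilate n e)"
        using orbit_tip[OF f e'] by (simp add: t)
      then show "cross f n s (p + e)" using tip by (auto simp: cross_def)
      have "diamond m (p - e)"
        using tip m(1) by (auto simp: units_def dilate_def)
      then show "cross f n s (p - e)" by (simp add: cross_def m)
      show "\<not> cross f n s (p + d)" if "d \<in> units" "d \<noteq> e" "d \<noteq> - e" for d
        using tip s that by (intro dead) (auto simp: units_def dilate_def m_def)
    qed
    ultimately show ?thesis by simp
  next
    case centre
    \<comment> \<open>Only a tip is within \<open>m\<close> of the origin and \<open>s\<close> of a
      centre. Hence even the neighbours of \<open>p\<close> stay at distance at least
      \<open>s\<close> from all centres, outside the copies.\<close>
    have far: "taxicab (p - dilate n e) > int s" if "e \<in> units" for e
      using taxicab_tip[OF that centre(2), of n] centre(1) that m by force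
    have "cross f n s q = diamond m q" if "q = p \<or> (\<exists>d\<in>units. q = p + d)" for q
    proof -
      have "\<not> orbit f s (q - dilate n e)" if "e \<in> units" for e
        using far[OF that] taxicab_unit[of _ "p - dilate n e"] near[of s "q - dilate n e"]
          \<open>q = p \<or> _\<close> by (force simp: algebra_simps)
      then show ?thesis by (auto simp: cross_def m)
    qed
    then have "CA f (cross f n s) p = CA f (diamond m) p"
      by (intro CA_local) blast+
    also have "\<dots> = diamond (m - 1) p"
      using CA_diamond[OF f m(1)] centre(1) by blast
    also have "\<dots> = cross f n (Suc s) p"
    proof -
      have "\<not> orbit f (Suc s) (p - dilate n e)" if "e \<in> units" for e
        using far[OF that] near[of "Suc s" "p - dilate n e"] by auto
      then show ?thesis by (auto simp: cross_def m)
    qed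
    finally show ?thesis .
  next
    case copy
    have far: "taxicab (p - dilate n d) > int s" if "d \<in> units" "d \<noteq> e" for d
      using taxicab_centres[of e d n p] that copy s by auto
    have "cross f n s q = orbit f s (q - dilate n e)" if "q = p \<or> (\<exists>d\<in>units. q = p + d)" for q
    proof -
      have "\<not> orbit f s (q - dilate n d)" if "d \<in> units" "d \<noteq> e" for d
        using far[OF that] taxicab_unit[of _ "p - dilate n d"] near[of s "q - dilate n d"]
          \<open>q = p \<or> _\<close> by (force simp: algebra_simps)
      moreover have "\<not> diamond m q"
        using that taxicab_unit[of _ p] copy(2) diamond_taxicab[of m q] by force
      ultimately show ?thesis using copy(1) by (auto simp: cross_def m)
    qed
    then have "CA f (cross f n s) p = CA f (\<lambda>q. orbit f s (q - dilate n e)) p"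
      by (intro CA_local) blast+
    also have "\<dots> = orbit f (Suc s) (p - dilate n e)"
      unfolding CA_shift using orbit_Suc[OF s(1)] by simp
    also have "\<dots> = cross f n (Suc s) p"
    proof -
      have "\<not> orbit f (Suc s) (p - dilate n d)" if "d \<in> units" "d \<noteq> e" for d
        using far[OF that] near[of "Suc s" "p - dilate n d"] by auto
      moreover have "\<not> diamond (m - 1) p"
        using copy(2) diamond_taxicab[of "m - 1" p] by auto
      ultimately show ?thesis using copy(1) by (auto simp: cross_def m)
    qed
    finally show ?thesis .
  next
    case far
    have "\<not> cross f n s (p + d)" if d: "d \<in> units" for d
    proof -
      have "\<not> orbit f s (p + d - dilate n e)" if "e \<in> units" for e
        using far(2)[OF that] taxicab_unit[OF d, of "p - dilate n e"] near[of s "p + d - dilate n e"]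
        by (force simp: algebra_simps)
      moreover have "\<not> diamond m (p + d)"
        using taxicab_unit[OF d, of p] far(1) diamond_taxicab[of m "p + d"] by force
      ultimately show ?thesis by (simp add: cross_def m)
    qed
    then have "\<not> CA f (cross f n s) p" using CA_live[OF f] by blast
    moreover have "\<not> cross f n (Suc s) p"
    proof -
      have "\<not> orbit f (Suc s) (p - dilate n e)" if "e \<in> units" for e
        using far(2)[OF that] near[of "Suc s" "p - dilate n e"] by auto
      moreover have "\<not> diamond (m - 1) p"
        using far(1) diamond_taxicab[of "m - 1" p] by auto
      ultimately show ?thesis by (simp add: cross_def m)
    qed
    ultimately show ?thesis by simp
  qed
qed

lemma cross_0: "cross f n 0 = diamond n"
  by (auto simp: cross_def)

text \<open>Each tip that the diamond emits is the seed of a copy. The step is separate because the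
  empty \<open>orbit f 0\<close> does not turn into the seed.\<close>

lemma cross_1:
  assumes f: "is_Ta_rule f" and n: "n \<ge> 1"
  shows "CA f (diamond n) = cross f n (Suc 0)"
proof
  fix p
  have "(\<exists>e\<in>units. seed (p - dilate n e)) \<longleftrightarrow> p \<in> dilate n ` units"
    by (auto simp: seed_def zero_prod_def[symmetric])
  then show "CA f (diamond n) p = cross f n (Suc 0) p"
    using CA_diamond[OF f n] by (simp add: cross_def)
qed

section \<open>Doubling, and the orbit between powers of two\<close>

text \<open>Sites with \<open>i + j\<close> odd miss both diagonals, and each of the four sectors
  between the diagonals holds one copy.\<close>

lemma diamond_double:
  "diamond (2 * n) p \<longleftrightarrow> (\<exists>e\<in>units. diamond n (p - dilate n e))"
proof -
  obtain i j where p: "p = (i, j)" by force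
  have parity:
    "diamond n (i - n, j) \<longleftrightarrow> odd (i + j) \<and> \<bar>i - n\<bar> + \<bar>j\<bar> < n"
    "diamond n (i + n, j) \<longleftrightarrow> odd (i + j) \<and> \<bar>i + n\<bar> + \<bar>j\<bar> < n"
    "diamond n (i, j - n) \<longleftrightarrow> odd (i + j) \<and> \<bar>i\<bar> + \<bar>j - n\<bar> < n"
    "diamond n (i, j + n) \<longleftrightarrow> odd (i + j) \<and> \<bar>i\<bar> + \<bar>j + n\<bar> < n"
    by (cases "even i"; cases "even j"; cases "even n"; simp)+
  have copies: "(\<exists>e\<in>units. diamond n (p - dilate n e)) \<longleftrightarrow>
      diamond n (i - n, j) \<or> diamond n (i + n, j) \<or> diamond n (i, j - n) \<or> diamond n (i, j + n)"
    by (simp add: p units_def dilate_def del: diamond.simps)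
  show ?thesis
  proof
    assume "diamond (2 * n) p"
    then have ij: "odd (i + j)" "\<bar>i\<bar> + \<bar>j\<bar> < 2 * n" by (simp_all add: p)
    then have "i \<noteq> j" "i \<noteq> - j" by auto
    then consider "\<bar>j\<bar> < i" | "\<bar>j\<bar> < - i" | "\<bar>i\<bar> < j" | "\<bar>i\<bar> < - j"
      by linarith
    then have "\<bar>i - n\<bar> + \<bar>j\<bar> < n \<or> \<bar>i + n\<bar> + \<bar>j\<bar> < n \<or> \<bar>i\<bar> + \<bar>j - n\<bar> < n \<or> \<bar>i\<bar> + \<bar>j + n\<bar> < n"
    proof cases
      case 1
      then have "\<bar>i - n\<bar> + \<bar>j\<bar> < n" using ij(2) by linarith
      then show ?thesis by blast
    next
      case 2
      then have "\<bar>i + n\<bar> + \<bar>j\<bar> < n" using ij(2) by linarith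
      then show ?thesis by blast
    next
      case 3
      then have "\<bar>i\<bar> + \<bar>j - n\<bar> < n" using ij(2) by linarith
      then show ?thesis by blast
    next
      case 4
      then have "\<bar>i\<bar> + \<bar>j + n\<bar> < n" using ij(2) by linarith
      then show ?thesis by blast
    qed
    then show "\<exists>e\<in>units. diamond n (p - dilate n e)"
      unfolding copies parity using ij(1) by blast
  next
    assume "\<exists>e\<in>units. diamond n (p - dilate n e)"
    then have copy: "odd (i + j)" "\<bar>i - n\<bar> + \<bar>j\<bar> < n \<or> \<bar>i + n\<bar> + \<bar>j\<bar> < n \<or>
        \<bar>i\<bar> + \<bar>j - n\<bar> < n \<or> \<bar>i\<bar> + \<bar>j + n\<bar> < n"
      unfolding copies parity by blast+
    from copy(2) have "\<bar>i\<bar> + \<bar>j\<bar> < 2 * n"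
      by (elim disjE; linarith)
    then show "diamond (2 * n) p" using copy(1) by (simp add: p)
  qed
qed

text \<open>An induction on \<open>s\<close> at fixed \<open>k\<close>, in \<open>spread\<close>,
  sits inside an induction on \<open>k\<close> that supplies the diamond at time
  \<open>2 ^ k\<close>.\<close>

lemma orbit_cross:
  assumes f: "is_Ta_rule f"
  shows "s \<le> 2 ^ k \<Longrightarrow> orbit f (2 ^ k + s) = cross f (2 ^ k) s"
proof (induction k arbitrary: s)
  have spread: "orbit f (2 ^ k + s) = cross f (2 ^ k) s"
    if "orbit f (2 ^ k) = diamond (2 ^ k)" "s \<le> 2 ^ k" for k s
    using that(2)
  proof (induction s)
    case 0
    then show ?case using that(1) by (simp add: cross_0)
  next
    case (Suc s)
    have "int s < 2 ^ k" using Suc.prems by (metis Suc_le_eq of_nat_less_iff of_nat_numeral of_nat_power)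
    have "orbit f (2 ^ k + Suc s) = CA f (cross f (2 ^ k) s)"
      using Suc by (simp add: orbit_Suc)
    also have "\<dots> = cross f (2 ^ k) (Suc s)"
    proof (cases "s = 0")
      case True
      then show ?thesis using cross_1[OF f, of "2 ^ k"] by (simp add: cross_0)
    next
      case False
      then show ?thesis using CA_cross[OF f _ \<open>int s < 2 ^ k\<close>] by auto
    qed
    finally show ?case .
  qed
  {
    case 0
    have "orbit f (2 ^ 0) = diamond (2 ^ 0)"
      by (auto simp: seed_def fun_eq_iff)
    then show ?case using spread[of 0] 0 by blast
  next
    case (Suc k)
    have "orbit f (2 ^ k) = diamond (2 ^ k)"
      using Suc.IH[of 0] by (simp add: cross_0)
    \<comment> \<open>At \<open>s = 2 ^ k\<close> the central diamond has shrunk to nothing and the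
      copies are diamonds of side \<open>2 ^ k\<close>, which fit together to the doubled
      one.\<close>
    moreover have "orbit f (2 ^ Suc k) = cross f (2 ^ k) (2 ^ k)"
      using Suc.IH[of "2 ^ k"] by (simp add: mult_2)
    moreover have "\<not> diamond 0 p" for p by (cases p) auto
    ultimately have "orbit f (2 ^ Suc k) = diamond (2 ^ Suc k)"
      using diamond_double[of "2 ^ k"] by (simp add: cross_def fun_eq_iff del: split_paired_All)
    then show ?case using spread[of "Suc k"] Suc.prems by blast
  }
qed

section \<open>Counting live cells\<close>

text \<open>Rotation by 45 degrees: \<open>j + i\<close> and \<open>j - i\<close>, shifted by
  \<open>n - 1\<close> and halved, run through an \<open>n\<close> by \<open>n\<close> square. The
  parity condition makes the halves integers.\<close>

lemma bij_betw_diamond: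
  "bij_betw (\<lambda>(a, b). (int a - int b, int a + int b - (int n - 1)))
     ({..<n} \<times> {..<n}) {p. diamond (int n) p}"
proof (rule bij_betwI[where g = "\<lambda>(i, j). (nat ((j + i + (int n - 1)) div 2), nat ((j - i + (int n - 1)) div 2))"])
  have bound: "\<bar>int a - int b\<bar> + \<bar>int a + int b - (int n - 1)\<bar> < int n" if "a < n" "b < n" for a b
    using that by arith
  show "(\<lambda>(a, b). (int a - int b, int a + int b - (int n - 1))) \<in> {..<n} \<times> {..<n} \<rightarrow> {p. diamond (int n) p}"
    using bound by auto
  have half: "2 * ((j + i + (int n - 1)) div 2) = j + i + (int n - 1)"
    "2 * ((j - i + (int n - 1)) div 2) = j - i + (int n - 1)"
    "\<bar>j + i\<bar> < int n" "\<bar>j - i\<bar> < int n" if "diamond (int n) (i, j)" for i j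
  proof -
    have "odd (i + j + int n)" using that by simp
    then have ev: "even (j + i + (int n - 1))" "even (j - i + (int n - 1))"
      by (cases "even i"; cases "even j"; simp)+
    show "2 * ((j + i + (int n - 1)) div 2) = j + i + (int n - 1)"
      using ev(1) by (rule dvd_mult_div_cancel)
    show "2 * ((j - i + (int n - 1)) div 2) = j - i + (int n - 1)"
      using ev(2) by (rule dvd_mult_div_cancel)
    have "\<bar>i\<bar> + \<bar>j\<bar> < int n" using that by simp
    then show "\<bar>j + i\<bar> < int n" "\<bar>j - i\<bar> < int n" by linarith+
  qed
  show "(\<lambda>(i, j). (nat ((j + i + (int n - 1)) div 2), nat ((j - i + (int n - 1)) div 2)))
      \<in> {p. diamond (int n) p} \<rightarrow> {..<n} \<times> {..<n}"
  proof
    fix p assume "p \<in> {p. diamond (int n) p}"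
    moreover obtain i j where p: "p = (i, j)" by force
    ultimately have "diamond (int n) (i, j)" by simp
    note h = half[OF this]
    have "(j + i + (int n - 1)) div 2 < int n" "(j - i + (int n - 1)) div 2 < int n"
      "(j + i + (int n - 1)) div 2 \<ge> 0" "(j - i + (int n - 1)) div 2 \<ge> 0"
      using h by linarith+
    then show "(\<lambda>(i, j). (nat ((j + i + (int n - 1)) div 2), nat ((j - i + (int n - 1)) div 2))) p
        \<in> {..<n} \<times> {..<n}"
      by (simp add: p nat_less_iff)
  qed
  show "(\<lambda>(i, j). (nat ((j + i + (int n - 1)) div 2), nat ((j - i + (int n - 1)) div 2)))
      ((\<lambda>(a, b). (int a - int b, int a + int b - (int n - 1))) p) = p" for p
    by (cases p) simp
  show "(\<lambda>(a, b). (int a - int b, int a + int b - (int n - 1)))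
      ((\<lambda>(i, j). (nat ((j + i + (int n - 1)) div 2), nat ((j - i + (int n - 1)) div 2))) p) = p"
    if "p \<in> {p. diamond (int n) p}" for p
  proof -
    obtain i j where p: "p = (i, j)" by force
    have "diamond (int n) (i, j)" using that p by simp
    note h = half[OF this]
    then have "(j + i + (int n - 1)) div 2 \<ge> 0" "(j - i + (int n - 1)) div 2 \<ge> 0" by linarith+
    then show ?thesis using h by (simp add: p)
  qed
qed

lemma finite_diamond: "finite {p. diamond (int n) p}"
  using bij_betw_finite[OF bij_betw_diamond[of n]] by simp

lemma card_diamond: "card {p. diamond (int n) p} = n\<^sup>2"
  using bij_betw_same_card[OF bij_betw_diamond[of n]]
  by (simp add: card_cartesian_product power2_eq_square)

lemma finite_orbit: "is_Ta_rule f \<Longrightarrow> finite {p. orbit f t p}"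
  by (rule finite_subset[OF _ finite_diamond[of t]]) (use orbit_diamond in blast)

text \<open>The support is finite, so the infinite sum is a true sum and not the default value
  0.\<close>

lemma num_a_eq_card:
  assumes "is_Ta_rule f"
  shows "num_a f t = card {p. orbit f t p}"
proof (cases "t = 0")
  case False
  have "num_a f t = (\<Sum>\<^sub>\<infinity>p\<in>UNIV. of_bool (orbit f t p))"
    using False by (simp add: num_a_def orbit_def)
  also have "\<dots> = (\<Sum>\<^sub>\<infinity>p\<in>{p. orbit f t p}. 1)"
    by (rule infsum_cong_neutral) auto
  also have "\<dots> = card {p. orbit f t p}"
    by (subst infsum_finite[OF finite_orbit[OF assms]]) simp
  finally show ?thesis .
qed (simp add: num_a_def)

lemma num_a_le_square: "is_Ta_rule f \<Longrightarrow> num_a f t \<le> t\<^sup>2"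
  unfolding num_a_eq_card card_diamond[symmetric]
  by (intro card_mono finite_diamond) (use orbit_diamond in blast)

text \<open>Disjointness is a matter of distance: the copies lie in open balls of radius
  \<open>s\<close> about centres \<open>2 * n\<close> apart, the diamond in the open ball of radius
  \<open>n - s\<close> about the origin.\<close>

lemma card_cross:
  assumes f: "is_Ta_rule f" and s: "s \<le> n"
  shows "card {p. cross f (int n) s p} = (n - s)\<^sup>2 + 4 * card {p. orbit f s p}"
proof -
  define K where "K e = (\<lambda>q. q + dilate (int n) e) ` {q. orbit f s q}" for e
  have K: "p \<in> K e \<longleftrightarrow> orbit f s (p - dilate (int n) e)" for p e
  proof
    assume "orbit f s (p - dilate (int n) e)"
    then show "p \<in> K e"
      unfolding K_def by (intro image_eqI[of _ _ "p - dilate (int n) e"]) simp_all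
  qed (auto simp: K_def)
  have near: "taxicab (p - dilate (int n) e) < int s" if "p \<in> K e" for p e
    using orbit_taxicab[OF f] that K by blast
  have cross: "{p. cross f (int n) s p} = {p. diamond (int (n - s)) p} \<union> (\<Union>e\<in>units. K e)"
    using s by (auto simp: cross_def K)
  have fin: "finite (K e)" for e
    unfolding K_def using finite_orbit[OF f] by blast
  have "K e \<inter> K d = {}" if "e \<in> units" "d \<in> units" "e \<noteq> d" for e d
  proof -
    have "p \<notin> K d" if "p \<in> K e" for p
      using near[of p e] near[of p d] taxicab_centres[of e d "int n" p] that s
        \<open>e \<in> units\<close> \<open>d \<in> units\<close> \<open>e \<noteq> d\<close> by force
    then show ?thesis by blast
  qed
  then have "card (\<Union>e\<in>units. K e) = (\<Sum>e\<in>units. card (K e))"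
    using fin by (intro card_UN_disjoint) (auto simp: units_def)
  also have "\<dots> = (\<Sum>e\<in>units. card {p. orbit f s p})"
    unfolding K_def by (intro sum.cong card_image) (auto simp: inj_on_def)
  also have "\<dots> = 4 * card {p. orbit f s p}"
    by (simp add: units_def)
  finally have copies: "card (\<Union>e\<in>units. K e) = 4 * card {p. orbit f s p}" .
  have "p \<notin> K e" if "diamond (int (n - s)) p" "e \<in> units" for p e
  proof
    assume "p \<in> K e"
    then have "taxicab (p - dilate (int n) e) < int s" by (rule near)
    moreover have "taxicab p < int n - int s"
      using diamond_taxicab[OF that(1)] s by simp
    ultimately show False
      using that(2) by (cases p) (auto simp: units_def dilate_def)
  qed
  then have "{p. diamond (int (n - s)) p} \<inter> (\<Union>e\<in>units. K e) = {}" by blast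
  then have "card {p. cross f (int n) s p} = card {p. diamond (int (n - s)) p} + card (\<Union>e\<in>units. K e)"
    unfolding cross using fin by (intro card_Un_disjoint finite_diamond finite_UN_I) (auto simp: units_def)
  then show ?thesis by (simp only: card_diamond copies)
qed

lemma num_a_recursion:
  assumes "is_Ta_rule f" "s \<le> 2 ^ k"
  shows "num_a f (2 ^ k + s) = (2 ^ k - s)\<^sup>2 + 4 * num_a f s"
  using orbit_cross[OF assms] card_cross[OF assms] by (simp add: num_a_eq_card assms(1))

section \<open>Binary digits\<close>

text \<open>A digit and its complement add up to 1, so the two sums give the all-ones number
  \<open>2 ^ (Suc k - M) - 1\<close>.\<close>

lemma digit_block_complement:
  fixes b :: "nat \<Rightarrow> nat"
  assumes "\<And>i. b i \<in> {0, 1}" "M \<le> Suc k"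
  shows "real (\<Sum>j=M..k. b j * 2 ^ (k - j)) + (\<Sum>j=M..k. (1 - real (b j)) * 2 ^ (k - j)) + 1
    = 2 ^ (Suc k - M)"
  using assms(2)
proof (induction rule: inc_induct)
  case (step M)
  then have "M \<le> k" by simp
  then show ?case
    using step.IH by (simp add: sum.atLeast_Suc_atMost[OF \<open>M \<le> k\<close>] Suc_diff_le algebra_simps)
qed simp

text \<open>Downward induction on the leading position \<open>M\<close>. A digit 0 changes nothing.
  A digit 1 splits the block as \<open>2 ^ (k - M) + s\<close>; the square in the recursion is the
  term \<open>i = M\<close>, and the factor 4 enters the prefix power.\<close>

lemma digit_recursion:
  fixes a :: "nat \<Rightarrow> nat" and b :: "nat \<Rightarrow> nat"
  assumes a0: "a 0 = 0"
    and rec: "\<And>k s. s \<le> 2 ^ k \<Longrightarrow> a (2 ^ k + s) = (2 ^ k - s)\<^sup>2 + 4 * a s"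
    and b: "\<And>i. b i \<in> {0, 1}" and "M \<le> Suc k"
  shows "4 ^ (\<Sum>j<M. b j) * real (a (\<Sum>j=M..k. b j * 2 ^ (k - j))) =
    (\<Sum>i=M..k. real (b i) * 4 ^ (\<Sum>j<i. b j) * (1 + (\<Sum>j=i..k. (1 - real (b j)) * 2 ^ (k - j)))\<^sup>2)"
  using assms(4)
proof (induction rule: inc_induct)
  case base
  then show ?case using a0 by simp
next
  case (step M)
  then have "M \<le> k" by simp
  note split = sum.atLeast_Suc_atMost[OF \<open>M \<le> k\<close>]
  define w where "w i = 1 + (\<Sum>j=i..k. (1 - real (b j)) * 2 ^ (k - j))" for i
  define s where "s = (\<Sum>j=Suc M..k. b j * 2 ^ (k - j))"
  have "b M = 0 \<or> b M = 1" using b[of M] by auto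
  then show ?case
  proof
    assume "b M = 0"
    then show ?thesis using step.IH by (simp add: split)
  next
    assume 1: "b M = 1"
    have compl: "real s + (\<Sum>j=Suc M..k. (1 - real (b j)) * 2 ^ (k - j)) + 1 = 2 ^ (k - M)"
      using digit_block_complement[OF b, of "Suc M" k] \<open>M \<le> k\<close> unfolding s_def by simp
    moreover have "(\<Sum>j=Suc M..k. (1 - real (b j)) * 2 ^ (k - j)) \<ge> 0"
    proof (rule sum_nonneg)
      fix j show "(1 - real (b j)) * 2 ^ (k - j) \<ge> 0" using b[of j] by auto
    qed
    ultimately have "real s \<le> 2 ^ (k - M)" by linarith
    then have s: "s \<le> 2 ^ (k - M)" by simp
    have "real (a (2 ^ (k - M) + s)) = (2 ^ (k - M) - real s)\<^sup>2 + 4 * real (a s)"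
      using rec[OF s] s by simp
    \<comment> \<open>The side of the diamond is one more than the complement of \<open>s\<close>;
      the sum may start at \<open>M\<close> because that digit is 1.\<close>
    also have "2 ^ (k - M) - real s = 1 + (\<Sum>j=M..k. (1 - real (b j)) * 2 ^ (k - j))"
      using compl by (simp add: split 1)
    finally show ?thesis
      using step.IH unfolding split[of "\<lambda>j. b j * 2 ^ (k - j)"] w_def[symmetric]
        split[of "\<lambda>i. real (b i) * 4 ^ (\<Sum>j<i. b j) * (w i)\<^sup>2"] s_def[symmetric]
      by (simp add: 1 algebra_simps)
  qed
qed

section \<open>Passage to the limit\<close>

lemma digit_limit:
  fixes a :: "nat \<Rightarrow> nat" and b :: "nat \<Rightarrow> nat"
  assumes a0: "a 0 = 0"
    and rec: "\<And>k s. s \<le> 2 ^ k \<Longrightarrow> a (2 ^ k + s) = (2 ^ k - s)\<^sup>2 + 4 * a s"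
    and le: "\<And>t. a t \<le> t\<^sup>2"
    and b: "\<And>i. b i \<in> {0, 1}" and zeros: "\<And>i. \<exists>j>i. b j = 0"
    and one: "(\<lambda>i. real (b i) / 2 ^ i) sums x" "x \<le> 1"
  defines "F \<equiv> \<lambda>k. real (a (\<Sum>j\<le>k. b j * 2 ^ (k - j))) / 4 ^ k"
    and "g \<equiv> \<lambda>i. real (b i) * 4 ^ (\<Sum>j<i. b j) * (\<Sum>j. (1 - real (b (i + j))) / 2 ^ (i + j))\<^sup>2"
  shows "\<exists>L. F \<longlonglongrightarrow> L \<and> g sums L \<and> 0 \<le> L \<and> L \<le> 1"
proof -
  have b01: "0 \<le> 1 - real (b j)" "1 - real (b j) \<le> 1" for j using b[of j] by auto
  \<comment> \<open>The summand \<open>1 / 2 ^ k\<close> is the 1 added to the complement, after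
    division by \<open>2 ^ k\<close>; it vanishes in the limit.\<close>
  define r where "r k i = (\<Sum>j=i..k. (1 - real (b j)) / 2 ^ j) + 1 / 2 ^ k" for k i
  define h where "h k i = real (b i) * 4 ^ (\<Sum>j<i. b j) * (r k i)\<^sup>2" for k i
  define T where "T M k = (\<Sum>j=M..k. b j * 2 ^ (k - j))" for M k
  have pow4: "((2 :: real) ^ n)\<^sup>2 = 4 ^ n" for n
    by (simp add: power2_eq_square flip: power_mult_distrib)
  have a_le: "real (a t) \<le> (real t)\<^sup>2" for t
    using le[of t] by (metis of_nat_le_iff of_nat_power)
  have r_lim: "(\<lambda>k. r k i) \<longlonglongrightarrow> (\<Sum>j. (1 - real (b (i + j))) / 2 ^ (i + j))" for i
  proof -
    have "summable (\<lambda>j. (1 - real (b (i + j))) / 2 ^ (i + j))"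
    proof (rule summable_comparison_test')
      show "summable (\<lambda>j. (1/2) ^ j :: real)" by simp
      show "norm ((1 - real (b (i + j))) / 2 ^ (i + j)) \<le> (1/2) ^ j" if "j \<ge> 0" for j
      proof -
        have "(1 - real (b (i + j))) / 2 ^ (i + j) \<le> 1 / 2 ^ j"
          using b01[of "i + j"] by (intro frac_le) (auto intro: power_increasing)
        then show ?thesis using b01[of "i + j"] by (simp add: power_divide)
      qed
    qed
    then have "(\<lambda>n. \<Sum>j<n. (1 - real (b (i + j))) / 2 ^ (i + j)) \<longlonglongrightarrow>
        (\<Sum>j. (1 - real (b (i + j))) / 2 ^ (i + j))"
      by (rule summable_LIMSEQ)
    moreover have "(\<Sum>j<n. (1 - real (b (i + j))) / 2 ^ (i + j)) =
        (\<Sum>j=i..<n+i. (1 - real (b j)) / 2 ^ j)" for n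
      by (subst sum.shift_bounds_nat_ivl[of _ 0 i n, simplified]) (simp add: add.commute lessThan_atLeast0)
    ultimately have "(\<lambda>n. \<Sum>j=i..<n+i. (1 - real (b j)) / 2 ^ j) \<longlonglongrightarrow>
        (\<Sum>j. (1 - real (b (i + j))) / 2 ^ (i + j))" by simp
    \<comment> \<open>Two index shifts turn sums of length \<open>n\<close> into sums ending at
      \<open>k\<close>: the first removes the offset \<open>i\<close>, the second closes the range
      at the top.\<close>
    then have "(\<lambda>n. \<Sum>j=i..<n. (1 - real (b j)) / 2 ^ j) \<longlonglongrightarrow>
        (\<Sum>j. (1 - real (b (i + j))) / 2 ^ (i + j))"
      by (rule LIMSEQ_offset)
    then have "(\<lambda>n. \<Sum>j=i..<Suc n. (1 - real (b j)) / 2 ^ j) \<longlonglongrightarrow>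
        (\<Sum>j. (1 - real (b (i + j))) / 2 ^ (i + j))"
      by (rule LIMSEQ_Suc)
    moreover have "(\<lambda>k. 1 / 2 ^ k :: real) \<longlonglongrightarrow> 0"
      using LIMSEQ_realpow_zero[of "1/2"] by (simp add: power_divide)
    ultimately show ?thesis
      unfolding r_def atLeastLessThanSuc_atLeastAtMost using tendsto_add by fastforce
  qed
  then have h_lim: "(\<lambda>k. h k i) \<longlonglongrightarrow> g i" for i
    unfolding h_def g_def by (intro tendsto_intros)
  have h_nonneg: "0 \<le> h k i" for k i by (simp add: h_def)
  \<comment> \<open>The terms from \<open>M\<close> on recombine to a single value of
    \<open>a\<close>; \<open>M = 0\<close> gives all of \<open>F k\<close>.\<close>
  have block: "(\<Sum>i=M..k. h k i) = 4 ^ (\<Sum>j<M. b j) * real (a (T M k)) / 4 ^ k"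
    if "M \<le> Suc k" for M k
  proof -
    have r_eq: "r k i = (1 + (\<Sum>j=i..k. (1 - real (b j)) * 2 ^ (k - j))) / 2 ^ k" for i
      unfolding r_def by (simp add: add_divide_distrib sum_divide_distrib power_diff)
    then have hk: "h k i = real (b i) * 4 ^ (\<Sum>j<i. b j) *
        (1 + (\<Sum>j=i..k. (1 - real (b j)) * 2 ^ (k - j)))\<^sup>2 / 4 ^ k" for i
      using r_eq by (simp only: h_def pow4 power_divide times_divide_eq_right)
    have "4 ^ (\<Sum>j<M. b j) * real (a (T M k)) = (\<Sum>i=M..k. real (b i) * 4 ^ (\<Sum>j<i. b j) *
        (1 + (\<Sum>j=i..k. (1 - real (b j)) * 2 ^ (k - j)))\<^sup>2)"
      unfolding T_def using that by (intro digit_recursion a0 rec b)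
    then show ?thesis
      by (simp only: hk sum_divide_distrib)
  qed
  \<comment> \<open>The factor 4 arises because the block has \<open>Suc k - M\<close> digits; the
    exponent is \<open>M\<close> less the number of ones, that is, the number of zeros.\<close>
  have tail: "(\<Sum>i=M..k. h k i) \<le> 4 * (1/4) ^ card {j. j < M \<and> b j = 0}" if "M \<le> Suc k" for M k
  proof -
    have "real (T M k) \<le> 2 ^ (Suc k - M)"
    proof -
      have "(\<Sum>j=M..k. (1 - real (b j)) * 2 ^ (k - j)) \<ge> 0"
        by (intro sum_nonneg mult_nonneg_nonneg b01) simp
      then show ?thesis
        using digit_block_complement[where b=b, OF b that] unfolding T_def by linarith
    qed
    then have "(real (T M k))\<^sup>2 \<le> (2 ^ (Suc k - M))\<^sup>2"
      by (intro power_mono) auto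
    then have "real (a (T M k)) \<le> 4 ^ (Suc k - M)"
      using a_le[of "T M k"] unfolding pow4 by linarith
    then have "(\<Sum>i=M..k. h k i) \<le> 4 ^ (\<Sum>j<M. b j) * 4 ^ (Suc k - M) / 4 ^ k"
      unfolding block[OF that] by (intro divide_right_mono mult_left_mono) auto
    also have "\<dots> = 4 * (4 ^ (\<Sum>j<M. b j) / 4 ^ M)"
      using that by (simp add: power_diff)
    also have "4 ^ (\<Sum>j<M. b j) / 4 ^ M = (1/4 :: real) ^ card {j. j < M \<and> b j = 0}"
    proof -
      have "(\<Sum>j<M. b j) + (\<Sum>j<M. of_bool (b j = 0)) = (\<Sum>j<M. 1)"
        unfolding sum.distrib[symmetric] by (rule sum.cong) (use b in force)+
      moreover have "(\<Sum>j<M. of_bool (b j = 0)) = card {j. j < M \<and> b j = 0}"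
        by (simp add: Int_def)
      ultimately have "M = (\<Sum>j<M. b j) + card {j. j < M \<and> b j = 0}" by simp
      then have "(4::real) ^ M = 4 ^ (\<Sum>j<M. b j) * 4 ^ card {j. j < M \<and> b j = 0}"
        by (metis power_add)
      then show ?thesis by (simp add: power_divide)
    qed
    finally show ?thesis .
  qed
  have F: "F k = (\<Sum>i=0..k. h k i)" for k
    using block[of 0 k] by (simp add: F_def T_def atLeast0AtMost)
  \<comment> \<open>At \<open>M = 0\<close> the bound \<open>tail\<close> gives only 4;
    \<open>x \<le> 1\<close> improves it to 1.\<close>
  have F_le1: "F k \<le> 1" for k
  proof -
    have "real (T 0 k) / 2 ^ k = (\<Sum>j\<le>k. real (b j) / 2 ^ j)"
      unfolding T_def atLeast0AtMost of_nat_sum sum_divide_distrib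
      by (intro sum.cong) (auto simp: power_diff[of "2 :: real"])
    also have "\<dots> \<le> x"
      using sum_le_suminf[OF sums_summable[OF one(1)], of "{..k}"] sums_unique[OF one(1)] by simp
    finally have "real (T 0 k) / 2 ^ k \<le> 1" using one(2) by linarith
    then have "(real (T 0 k))\<^sup>2 \<le> (2 ^ k)\<^sup>2"
      by (intro power_mono) auto
    then have "real (a (T 0 k)) \<le> 4 ^ k"
      using a_le[of "T 0 k"] unfolding pow4 by linarith
    then show ?thesis by (simp add: F_def T_def atLeast0AtMost)
  qed
  have zeros_lim: "(\<lambda>M. 4 * (1/4 :: real) ^ card {j. j < M \<and> b j = 0}) \<longlonglongrightarrow> 0"
  proof -
    have "filterlim (\<lambda>M. card {j. j < M \<and> b j = 0}) at_top sequentially"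
      unfolding filterlim_at_top
    proof
      fix Z
      have inf: "infinite {j. b j = 0}"
        unfolding infinite_nat_iff_unbounded using zeros by blast
      obtain S where S: "S \<subseteq> {j. b j = 0}" "finite S" "card S = Z"
        using infinite_arbitrarily_large[OF inf] by blast
      obtain K where K: "S \<subseteq> {..<K}"
        using S(2) finite_nat_iff_bounded by blast
      have "Z \<le> card {j. j < M \<and> b j = 0}" if "M \<ge> K" for M
        unfolding S(3)[symmetric] using S K that by (intro card_mono) auto
      then show "\<forall>\<^sub>F M in sequentially. Z \<le> card {j. j < M \<and> b j = 0}"
        using eventually_sequentially by blast
    qed
    moreover have "(\<lambda>n. 4 * (1/4 :: real) ^ n) \<longlonglongrightarrow> 0"
      by (intro tendsto_mult_right_zero LIMSEQ_realpow_zero) auto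
    ultimately show ?thesis
      by (rule filterlim_compose[rotated])
  qed
  have g_nonneg: "0 \<le> g i" for i by (simp add: g_def)
  have split: "F k = (\<Sum>i<M. h k i) + (\<Sum>i=M..k. h k i)" if "M \<le> k" for M k
    unfolding F using that by (subst sum.atLeastLessThan_concat[of 0 M "Suc k", symmetric, simplified atLeastLessThanSuc_atLeastAtMost]) (auto simp: lessThan_atLeast0)
  have g_part: "(\<Sum>i<M. g i) \<le> 1" for M
  proof (rule LIMSEQ_le_const2)
    show "(\<lambda>k. \<Sum>i<M. h k i) \<longlonglongrightarrow> (\<Sum>i<M. g i)"
      by (intro tendsto_sum h_lim)
    have "(\<Sum>i<M. h k i) \<le> 1" if "M \<le> k" for k
    proof -
      have "0 \<le> (\<Sum>i=M..k. h k i)" by (intro sum_nonneg h_nonneg)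
      then show ?thesis using F_le1[of k] split[OF that] by linarith
    qed
    then show "\<exists>N. \<forall>k\<ge>N. (\<Sum>i<M. h k i) \<le> 1" by blast
  qed
  have summ: "summable g"
    using g_nonneg
  proof (rule bounded_imp_summable)
    show "(\<Sum>i\<le>n. g i) \<le> 1" for n
      using g_part[of "Suc n"] by (simp add: lessThan_Suc_atMost)
  qed
  have "F \<longlonglongrightarrow> suminf g"
  proof (rule LIMSEQ_I)
    fix \<epsilon> :: real assume "\<epsilon> > 0"
    then have e: "\<epsilon> / 3 > 0" by simp
    obtain M1 where M1: "\<And>M. M \<ge> M1 \<Longrightarrow> norm (4 * (1/4 :: real) ^ card {j. j < M \<and> b j = 0} - 0) < \<epsilon> / 3"
      using LIMSEQ_D[OF zeros_lim e] by blast
    obtain M2 where M2: "\<And>M. M \<ge> M2 \<Longrightarrow> norm ((\<Sum>i<M. g i) - suminf g) < \<epsilon> / 3"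
      using LIMSEQ_D[OF summable_LIMSEQ[OF summ] e] by blast
    \<comment> \<open>\<open>M\<close> is fixed first, from the tail bound and the series; only then
      is \<open>K\<close> chosen for the finite sum below \<open>M\<close>.\<close>
    define M where "M = max M1 M2"
    have "(\<lambda>k. \<Sum>i<M. h k i) \<longlonglongrightarrow> (\<Sum>i<M. g i)"
      by (intro tendsto_sum h_lim)
    then obtain K where K: "\<And>k. k \<ge> K \<Longrightarrow> norm ((\<Sum>i<M. h k i) - (\<Sum>i<M. g i)) < \<epsilon> / 3"
      using LIMSEQ_D[OF _ e] by blast
    have "norm (F k - suminf g) < \<epsilon>" if "k \<ge> max K M" for k
    proof -
      have "0 \<le> (\<Sum>i=M..k. h k i)" by (intro sum_nonneg h_nonneg)
      moreover have "(\<Sum>i=M..k. h k i) < \<epsilon> / 3"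
        using tail[of M k] M1[of M] that by (simp add: M_def)
      moreover have "F k = (\<Sum>i<M. h k i) + (\<Sum>i=M..k. h k i)"
        using that by (intro split) simp
      moreover have "norm ((\<Sum>i<M. h k i) - (\<Sum>i<M. g i)) < \<epsilon> / 3"
        using that by (intro K) simp
      moreover have "norm ((\<Sum>i<M. g i) - suminf g) < \<epsilon> / 3"
        by (intro M2) (simp add: M_def)
      ultimately show ?thesis unfolding real_norm_def by linarith
    qed
    then show "\<exists>no. \<forall>n\<ge>no. norm (F n - suminf g) < \<epsilon>" by blast
  qed
  moreover have "suminf g \<le> 1"
    by (rule suminf_le_const[OF summ g_part])
  ultimately show ?thesis
    using summable_sums[OF summ] suminf_nonneg[OF summ g_nonneg] by blast
qed

section \<open>The adopted expansion and the theorem\<close>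

lemma digit_floor_digit: "x \<in> {0..1} \<Longrightarrow> digit x = floor_digit x"
  by (rule ext) (simp add: digit_eq_floor floor_digit_def)

lemma digit_expansion: "x \<in> {0..1} \<Longrightarrow> binary_expansion x (digit x)"
  using floor_digit_expansion by (simp only: digit_floor_digit)

lemma digit_bit: "x \<in> {0..1} \<Longrightarrow> digit x i \<in> {0, 1}"
  using digit_expansion unfolding binary_expansion_def by blast

text \<open>A tail of ones would make \<open>x\<close> dyadic, and there the adopted expansion has
  only finitely many ones. The zeros are what makes the tail bound tend to 0.\<close>

lemma digit_zero_infinitely_often:
  assumes x: "x \<in> {0..1}"
  shows "\<exists>j>i. digit x j = 0"
proof (rule ccontr)
  assume "\<not> ?thesis"
  then have ones: "\<forall>j>i. digit x j = 1" using digit_bit[OF x] by blast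
  have "finite {j. floor_digit x j \<noteq> 0}"
    by (rule finite_floor_digit[OF digit_expansion[OF x] ones])
  moreover have "{i<..} \<subseteq> {j. floor_digit x j \<noteq> 0}"
    using ones unfolding digit_floor_digit[OF x] by auto
  ultimately show False using finite_subset infinite_Ioi by blast
qed

text \<open>The truncation determines its numerator, so the definite description picks it; the
  normalization \<open>4 ^ k\<close> is the recursion at \<open>s = 0\<close>.\<close>

lemma F_dyadic_trunc:
  assumes "is_Ta_rule f"
  shows "F_dyadic f k (trunc x k) = real (num_a f (\<Sum>j\<le>k. digit x j * 2 ^ (k - j))) / 4 ^ k"
proof -
  define t where "t = (\<Sum>j\<le>k. digit x j * 2 ^ (k - j))"
  have "trunc x k = real t / 2 ^ k"
    unfolding trunc_def t_def of_nat_sum sum_divide_distrib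
    by (intro sum.cong) (auto simp: power_diff[of "2 :: real"])
  then have "(THE t. trunc x k = real t / 2 ^ k) = t"
    by (intro the_equality) simp_all
  moreover have "num_a f (2 ^ k) = 4 ^ k"
    using num_a_recursion[OF assms, of 0 k]
    by (simp add: num_a_def[of f 0] power2_eq_square flip: power_mult_distrib)
  ultimately show ?thesis by (simp add: F_dyadic_def t_def)
qed

theorem theorem1:
  fixes f :: rule and x :: real
  assumes "is_Ta_rule f" and "x \<in> {0..1}"
  shows "convergent (\<lambda>k. F_dyadic f k (trunc x k)) \<and>
    F_limit f x \<in> {0..1} \<and>
    (\<lambda>i. real (digit x i) * 4 ^ (\<Sum>j<i. digit x j) *
          (\<Sum>j. (1 - real (digit x (i + j))) / 2 ^ (i + j))\<^sup>2) sums F_limit f x"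
proof -
  let ?F = "\<lambda>k. F_dyadic f k (trunc x k)"
  have zero: "num_a f 0 = 0" by (simp add: num_a_def)
  have x: "(\<lambda>i. real (digit x i) / 2 ^ i) sums x" "x \<le> 1"
    using digit_expansion[OF assms(2)] assms(2) unfolding binary_expansion_def by auto
  obtain L where L: "?F \<longlonglongrightarrow> L"
    "(\<lambda>i. real (digit x i) * 4 ^ (\<Sum>j<i. digit x j) *
      (\<Sum>j. (1 - real (digit x (i + j))) / 2 ^ (i + j))\<^sup>2) sums L" "0 \<le> L" "L \<le> 1"
    using digit_limit[OF zero num_a_recursion[OF assms(1)] num_a_le_square[OF assms(1)]
      digit_bit[OF assms(2)] digit_zero_infinitely_often[OF assms(2)] x]
    unfolding F_dyadic_trunc[OF assms(1)] by blast
  have "convergent ?F" using L(1) by (rule convergentI)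
  moreover have "F_limit f x = L" unfolding F_limit_def using L(1) by (rule limI)
  ultimately show ?thesis using L(2-4) by simp
qed

end
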